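(* Let $H_0\colon D(H_0)\subseteq\mathcal{H}\to\mathcal{H}$ be a densely defined, closed, skew-symmetric operator on a Hilbert space $\mathcal{H}$ and let $(\mathcal{G},\Gamma_1,\Gamma_2)$ be a boundary triplet for $H_0$. Let $\Omega$ be the standard symmetric form on $\mathcal{H}\oplus\mathcal{H}$, let $\omega$ be the standard unitary form on $\mathcal{G}\oplus\mathcal{G}$, and let $F\colon\operatorname{Graph}(H_0^{\star})\to\mathcal{G}\oplus\mathcal{G}$ be given by $$F(x,H_0^{\star}x)=\Bigl(\tfrac{1}{\sqrt{2}}(\Gamma_1x+\Gamma_2x),\tfrac{1}{\sqrt{2}}(\Gamma_1x-\Gamma_2x)\Bigr),\qquad x\in D(H_0^\star).$$ Then $(\Omega,\mathcal{G},\mathcal{G},F,\omega)$ is a boundary system for $H_0$. Moreover, the characterization of skew-self-adjoint extensions via the boundary triplet arises from the characterization via the boundary system by multiplication with $-1$; that is, writing $F(x,H_0^\star x)=(F_1x,F_2x)$, for every unitary operator $L\colon\mathcal{G}\to\mathcal{G}$ one has $$\{x\in D(H_0^{\star}) : (L-1)\Gamma_1x+(L+1)\Gamma_2x=0\}=\{x\in D(H_0^{\star}) : LF_1x=F_2x\}=:D_L,$$ and hence the operator $-H_0^{\star}|_{D_L}$ associated with $L$ via the boundary triplet equals $-1$ times the operator $H_0^{\star}|_{D_L}$ associated with $L$ via the boundary system.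
   Context: $H_0$ is skew-symmetric if $H_0\subseteq -H_0^\star$. A densely defined operator $H$ is skew-self-adjoint if $H=-H^\star$. Note $D(-H_0^\star)=D(H_0^\star)$. Boundary system for $H_0$: a quintuple $(\Omega,\mathcal{G}_1,\mathcal{G}_2,F,\omega)$ where $\Omega$ is a sesquilinear form on $\mathcal{H}\oplus\mathcal{H}$, $\mathcal{G}_1,\mathcal{G}_2$ are Hilbert spaces, $\omega$ is a sesquilinear form on $\mathcal{G}_1\oplus\mathcal{G}_2$, and $F\colon\operatorname{Graph}(H_0^{\star})\to\mathcal{G}_1\oplus\mathcal{G}_2$ is a surjective map such that $\Omega((x,H_0^{\star}x),(y,H_0^{\star}y))=\omega(F(x,H_0^{\star}x),F(y,H_0^{\star}y))$ for all $x,y\in D(H_0^{\star})$. Standard symmetric form on $\mathcal{H}\oplus\mathcal{H}$: $\Omega((x,y),(u,v))=(x,v)_{\mathcal{H}}+(y,u)_{\mathcal{H}}$. Standard unitary form on $\mathcal{G}_1\oplus\mathcal{G}_2$: $\omega((x,y),(u,v))=(x,u)_{\mathcal{G}_1}-(y,v)_{\mathcal{G}_2}$. Boundary triplet for $H_0$: a triple $(\mathcal{G},\Gamma_1,\Gamma_2)$ where $\mathcal{G}$ is a Hilbert space and $\Gamma_1,\Gamma_2\colon D(-H_0^{\star})\to\mathcal{G}$ are linear maps such that $D(-H_0^{\star})\to\mathcal{G}\oplus\mathcal{G}$, $x\mapsto(\Gamma_1x,\Gamma_2x)$ is surjective and $(H_0^{\star}x,y)_{\mathcal{H}}+(x,H_0^{\star}y)_{\mathcal{H}}=(\Gamma_1x,\Gamma_2y)_{\mathcal{G}}+(\Gamma_2x,\Gamma_1y)_{\mathcal{G}}$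 for all $x,y\in D(-H_0^{\star})$. Known characterizations referred to in the claim. Via a boundary triplet: $H\supseteq H_0$ is skew-self-adjoint iff there is a unitary $L\colon\mathcal{G}\to\mathcal{G}$ with $D(H)=\{x\in D(-H_0^\star):(L-1)\Gamma_1x+(L+1)\Gamma_2x=0\}$ and $H=-H_0^\star|_{D(H)}$. Via a boundary system with $\Omega$ standard symmetric and $\omega$ standard unitary: $H\subseteq H_0^\star$ is skew-self-adjoint iff there is a unitary $L\colon\mathcal{G}_1\to\mathcal{G}_2$ with $D(H)=\{x\in D(H_0^\star): LF_1x=F_2x\}$, where $F_ix$ is the $i$-th component of $F(x,H_0^\star x)$. *)

theory Defs
  imports "HOL-Analysis.Analysis"
begin

text \<open>
  Complex Hilbert spaces, with inner product linear in the first and conjugate-linear in the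
  second argument. The superclass supplies the underlying complete real normed space.
\<close>

class complex_hilbert = banach +
  fixes scaleC :: "complex \<Rightarrow> 'a \<Rightarrow> 'a"  (infixr \<open>*\<^sub>C\<close> 75)
    and cinner :: "'a \<Rightarrow> 'a \<Rightarrow> complex"
  assumes scaleC_add_right: "a *\<^sub>C (x + y) = a *\<^sub>C x + a *\<^sub>C y"
    and scaleC_add_left: "(a + b) *\<^sub>C x = a *\<^sub>C x + b *\<^sub>C x"
    and scaleC_scaleC: "a *\<^sub>C (b *\<^sub>C x) = (a * b) *\<^sub>C x"
    and scaleC_of_real: "complex_of_real r *\<^sub>C x = r *\<^sub>R x"
    and cinner_commute: "cinner x y = cnj (cinner y x)"
    and cinner_add_left: "cinner (x + y) z = cinner x z + cinner y z"
    and cinner_scaleC_left: "cinner (a *\<^sub>C x) y = a * cinner x y"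
    and cinner_self: "cinner x x = complex_of_real ((norm x)\<^sup>2)"

instantiation complex :: complex_hilbert
begin

definition scaleC_complex :: "complex \<Rightarrow> complex \<Rightarrow> complex"
  where "scaleC_complex a x = a * x"

definition cinner_complex :: "complex \<Rightarrow> complex \<Rightarrow> complex"
  where "cinner_complex x y = x * cnj y"

instance
  by standard
    (simp_all add: scaleC_complex_def cinner_complex_def algebra_simps scaleR_conv_of_real
      complex_norm_square flip: of_real_power)

end

instantiation prod :: (complex_hilbert, complex_hilbert) complex_hilbert
begin

definition scaleC_prod :: "complex \<Rightarrow> 'a \<times> 'b \<Rightarrow> 'a \<times> 'b"
  where "scaleC_prod a p = (a *\<^sub>C fst p, a *\<^sub>C snd p)"

definition cinner_prod :: "'a \<times> 'b \<Rightarrow> 'a \<times> 'b \<Rightarrow> complex"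
  where "cinner_prod p q = cinner (fst p) (fst q) + cinner (snd p) (snd q)"

instance
proof
  fix p q :: "'a \<times> 'b"
  show "cinner p q = cnj (cinner q p)"
    unfolding cinner_prod_def complex_cnj_add
    using cinner_commute[of "fst p" "fst q"] cinner_commute[of "snd p" "snd q"] by simp
qed (simp_all add: scaleC_prod_def cinner_prod_def scaleC_add_right scaleC_add_left
    scaleC_scaleC scaleC_of_real cinner_add_left cinner_scaleC_left cinner_self norm_prod_def
    prod_eq_iff algebra_simps)

end

global_interpretation complex_vector: vector_space "scaleC :: complex \<Rightarrow> 'a \<Rightarrow> 'a::complex_hilbert"
  defines csubspace = complex_vector.subspace
proof
  show "1 *\<^sub>C x = x" for x :: 'a
    using scaleC_of_real[of 1 x] by simp
qed (simp_all add: scaleC_add_right scaleC_add_left scaleC_scaleC)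

definition clinear_on :: "'a::complex_hilbert set \<Rightarrow> ('a \<Rightarrow> 'b::complex_hilbert) \<Rightarrow> bool"
  where "clinear_on D f \<longleftrightarrow>
    csubspace D \<and>
    (\<forall>x\<in>D. \<forall>y\<in>D. f (x + y) = f x + f y) \<and>
    (\<forall>c. \<forall>x\<in>D. f (c *\<^sub>C x) = c *\<^sub>C f x)"

definition sesquilinear_form :: "('a::complex_hilbert \<Rightarrow> 'a \<Rightarrow> complex) \<Rightarrow> bool"
  where "sesquilinear_form B \<longleftrightarrow>
    (\<forall>x y z. B (x + y) z = B x z + B y z) \<and>
    (\<forall>c x y. B (c *\<^sub>C x) y = c * B x y) \<and>
    (\<forall>x y z. B x (y + z) = B x y + B x z) \<and>
    (\<forall>c x y. B x (c *\<^sub>C y) = cnj c * B x y)"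

definition unitary_operator :: "('a::complex_hilbert \<Rightarrow> 'b::complex_hilbert) \<Rightarrow> bool"
  where "unitary_operator L \<longleftrightarrow>
    clinear_on UNIV L \<and> surj L \<and> (\<forall>x y. cinner (L x) (L y) = cinner x y)"

text \<open>
  A (generally unbounded) operator is identified with its graph: its domain is \<^const>\<open>Domain\<close>,
  closedness is topological closedness in the product space, and \<^term>\<open>(\<subseteq>)\<close> is extension of
  operators.
\<close>

definition linear_operator :: "('a::complex_hilbert \<times> 'b::complex_hilbert) set \<Rightarrow> bool"
  where "linear_operator T \<longleftrightarrow> csubspace T \<and> single_valued T"

definition op_apply :: "('a \<times> 'b) set \<Rightarrow> 'a \<Rightarrow> 'b"
  where "op_apply T x = (THE y. (x, y) \<in> T)"

definition op_uminus :: "('a \<times> 'b::uminus) set \<Rightarrow> ('a \<times> 'b) set"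
  where "op_uminus T = {(x, - y) | x y. (x, y) \<in> T}"

definition op_restrict :: "('a \<times> 'b) set \<Rightarrow> 'a set \<Rightarrow> ('a \<times> 'b) set"
  where "op_restrict T D = {(x, y). (x, y) \<in> T \<and> x \<in> D}"

definition densely_defined :: "('a::topological_space \<times> 'b) set \<Rightarrow> bool"
  where "densely_defined T \<longleftrightarrow> closure (Domain T) = UNIV"

text \<open>For densely defined \<^term>\<open>T\<close> this relation is again (the graph of) an operator.\<close>

definition adjoint_op ::
    "('a::complex_hilbert \<times> 'b::complex_hilbert) set \<Rightarrow> ('b \<times> 'a) set"
  where "adjoint_op T = {(u, v). \<forall>(x, y)\<in>T. cinner y u = cinner x v}"

definition skew_symmetric :: "('a::complex_hilbert \<times> 'a) set \<Rightarrow> bool"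
  where "skew_symmetric T \<longleftrightarrow> T \<subseteq> op_uminus (adjoint_op T)"

definition standard_symmetric_form ::
    "'a::complex_hilbert \<times> 'a \<Rightarrow> 'a \<times> 'a \<Rightarrow> complex"
  where "standard_symmetric_form = (\<lambda>(x, y) (u, v). cinner x v + cinner y u)"

definition standard_unitary_form ::
    "'a::complex_hilbert \<times> 'b::complex_hilbert \<Rightarrow> 'a \<times> 'b \<Rightarrow> complex"
  where "standard_unitary_form = (\<lambda>(x, y) (u, v). cinner x u - cinner y v)"

text \<open>
  The Hilbert spaces belonging to a boundary system or boundary triplet are given by the types.
  Only the values of the maps on \<^term>\<open>adjoint_op H0\<close>, resp. its domain, are relevant.
\<close>

definition boundary_system ::
    "('h::complex_hilbert \<times> 'h) set \<Rightarrow>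
     ('h \<times> 'h \<Rightarrow> 'h \<times> 'h \<Rightarrow> complex) \<Rightarrow>
     ('h \<times> 'h \<Rightarrow> 'g1::complex_hilbert \<times> 'g2::complex_hilbert) \<Rightarrow>
     ('g1 \<times> 'g2 \<Rightarrow> 'g1 \<times> 'g2 \<Rightarrow> complex) \<Rightarrow> bool"
  where "boundary_system H0 \<Omega> F \<omega> \<longleftrightarrow>
    sesquilinear_form \<Omega> \<and> sesquilinear_form \<omega> \<and>
    F ` adjoint_op H0 = UNIV \<and>
    (\<forall>x\<in>Domain (adjoint_op H0). \<forall>y\<in>Domain (adjoint_op H0).
      \<Omega> (x, op_apply (adjoint_op H0) x) (y, op_apply (adjoint_op H0) y) =
      \<omega> (F (x, op_apply (adjoint_op H0) x)) (F (y, op_apply (adjoint_op H0) y)))"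

definition boundary_triplet ::
    "('h::complex_hilbert \<times> 'h) set \<Rightarrow> ('h \<Rightarrow> 'g::complex_hilbert) \<Rightarrow> ('h \<Rightarrow> 'g) \<Rightarrow> bool"
  where "boundary_triplet H0 \<Gamma>1 \<Gamma>2 \<longleftrightarrow>
    (let D = Domain (op_uminus (adjoint_op H0)) in
      clinear_on D \<Gamma>1 \<and> clinear_on D \<Gamma>2 \<and>
      (\<lambda>x. (\<Gamma>1 x, \<Gamma>2 x)) ` D = UNIV \<and>
      (\<forall>x\<in>D. \<forall>y\<in>D.
        cinner (op_apply (adjoint_op H0) x) y + cinner x (op_apply (adjoint_op H0) y) =
        cinner (\<Gamma>1 x) (\<Gamma>2 y) + cinner (\<Gamma>2 x) (\<Gamma>1 y)))"

definition triplet_domain ::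
    "('h::complex_hilbert \<times> 'h) set \<Rightarrow> ('h \<Rightarrow> 'g::complex_hilbert) \<Rightarrow> ('h \<Rightarrow> 'g) \<Rightarrow>
     ('g \<Rightarrow> 'g) \<Rightarrow> 'h set"
  where "triplet_domain H0 \<Gamma>1 \<Gamma>2 L =
    {x \<in> Domain (adjoint_op H0). (L (\<Gamma>1 x) - \<Gamma>1 x) + (L (\<Gamma>2 x) + \<Gamma>2 x) = 0}"

definition system_domain ::
    "('h::complex_hilbert \<times> 'h) set \<Rightarrow>
     ('h \<times> 'h \<Rightarrow> 'g1::complex_hilbert \<times> 'g2::complex_hilbert) \<Rightarrow> ('g1 \<Rightarrow> 'g2) \<Rightarrow> 'h set"
  where "system_domain H0 F L =
    {x \<in> Domain (adjoint_op H0).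
      L (fst (F (x, op_apply (adjoint_op H0) x))) = snd (F (x, op_apply (adjoint_op H0) x))}"

definition triplet_operator ::
    "('h::complex_hilbert \<times> 'h) set \<Rightarrow> ('h \<Rightarrow> 'g::complex_hilbert) \<Rightarrow> ('h \<Rightarrow> 'g) \<Rightarrow>
     ('g \<Rightarrow> 'g) \<Rightarrow> ('h \<times> 'h) set"
  where "triplet_operator H0 \<Gamma>1 \<Gamma>2 L =
    op_restrict (op_uminus (adjoint_op H0)) (triplet_domain H0 \<Gamma>1 \<Gamma>2 L)"

definition system_operator ::
    "('h::complex_hilbert \<times> 'h) set \<Rightarrow>
     ('h \<times> 'h \<Rightarrow> 'g1::complex_hilbert \<times> 'g2::complex_hilbert) \<Rightarrow> ('g1 \<Rightarrow> 'g2) \<Rightarrow> ('h \<times> 'h) set"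
  where "system_operator H0 F L = op_restrict (adjoint_op H0) (system_domain H0 F L)"

end

theory Submission imports Defs begin

text \<open>
  Up to the factor \<open>1 / sqrt 2\<close>, the map \<open>F\<close> is the rotation \<open>(a, b) \<mapsto> (a + b, a - b)\<close> applied to
  \<open>(\<Gamma>1 x, \<Gamma>2 x)\<close>. This rotation is invertible and turns the standard unitary form into the
  standard symmetric form, and \<open>L (a + b) = a - b\<close> is a rearrangement of
  \<open>(L - 1) a + (L + 1) b = 0\<close>.
\<close>

lemma cinner_add_right: "cinner x (y + z) = cinner x y + cinner x z"
  for x y z :: "'a::complex_hilbert"
  by (metis cinner_commute cinner_add_left complex_cnj_add)

lemma cinner_scaleC_right: "cinner x (c *\<^sub>C y) = cnj c * cinner x y"
  for x y :: "'a::complex_hilbert"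
  by (metis cinner_commute cinner_scaleC_left complex_cnj_mult)

lemma cinner_diff_left: "cinner (x - y) z = cinner x z - cinner y z"
  for x y z :: "'a::complex_hilbert"
  using cinner_add_left[of "x - y" y z] by simp

lemma cinner_diff_right: "cinner x (y - z) = cinner x y - cinner x z"
  for x y z :: "'a::complex_hilbert"
  using cinner_add_right[of x "y - z" z] by simp

lemma sesquilinear_standard_symmetric_form: "sesquilinear_form standard_symmetric_form"
  by (auto simp: sesquilinear_form_def standard_symmetric_form_def scaleC_prod_def
      cinner_add_left cinner_add_right cinner_scaleC_left cinner_scaleC_right algebra_simps)

lemma sesquilinear_standard_unitary_form: "sesquilinear_form standard_unitary_form"
  by (auto simp: sesquilinear_form_def standard_unitary_form_def scaleC_prod_def
      cinner_add_left cinner_add_right cinner_scaleC_left cinner_scaleC_right algebra_simps)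

lemma eq_zero_if_orthogonal_to_dense:
  fixes w :: "'a::complex_hilbert"
  assumes "closure D = UNIV" and orth: "\<And>x. x \<in> D \<Longrightarrow> cinner x w = 0"
  shows "w = 0"
proof -
  txt \<open>The Pythagorean identity is a closed condition on \<open>x\<close>, so it extends to \<open>x = w\<close>.\<close>
  let ?S = "{x. (norm (x - w))\<^sup>2 = (norm x)\<^sup>2 + (norm w)\<^sup>2}"
  have "closed ?S"
    by (intro closed_Collect_eq continuous_intros)
  moreover have "D \<subseteq> ?S"
  proof
    fix x assume "x \<in> D"
    then have "cinner x w = 0" "cinner w x = 0"
      using orth cinner_commute[of w x] by auto
    then have "cinner (x - w) (x - w) = cinner x x + cinner w w"
      by (simp add: cinner_diff_left cinner_diff_right)
    then show "x \<in> ?S"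
      by (simp add: cinner_self flip: of_real_add of_real_power)
  qed
  ultimately have "closure D \<subseteq> ?S"
    by (rule closure_minimal[rotated])
  then have "w \<in> ?S"
    using assms(1) by blast
  \<comment> \<open>At \<open>x = w\<close> the identity reads
    \<open>0 = 2 * (norm w)\<^sup>2\<close>.\<close>
  then show ?thesis
    by simp
qed

text \<open>Two values at the same \<open>u\<close> differ by a vector orthogonal to the dense
  domain. This makes the definite description in \<open>op_apply\<close> meaningful for the
  adjoint.\<close>

lemma single_valued_adjoint_op:
  assumes "densely_defined T"
  shows "single_valued (adjoint_op T)"
proof (rule single_valuedI)
  fix u v v' assume "(u, v) \<in> adjoint_op T" "(u, v') \<in> adjoint_op T"
  then have "cinner x (v - v') = 0" if "x \<in> Domain T" for x
    using that by (fastforce simp: adjoint_op_def cinner_diff_right)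
  then have "v - v' = 0"
    using assms eq_zero_if_orthogonal_to_dense unfolding densely_defined_def by blast
  then show "v = v'"
    by simp
qed

lemma op_apply_in_graph:
  assumes "single_valued T" "x \<in> Domain T"
  shows "(x, op_apply T x) \<in> T"
proof -
  obtain y where y: "(x, y) \<in> T"
    using assms(2) by blast
  then have "op_apply T x = y"
    unfolding op_apply_def using assms(1) by (blast intro: the_equality dest: single_valuedD)
  with y show ?thesis
    by simp
qed

lemma Domain_op_uminus [simp]: "Domain (op_uminus T) = Domain T"
  by (auto simp: op_uminus_def)

text \<open>Restriction tests only the first component and negation changes only the second. This is
  the source of the factor -1 between the two associated operators.\<close>

lemma op_restrict_op_uminus: "op_restrict (op_uminus T) D = op_uminus (op_restrict T D)"
  by (auto simp: op_restrict_def op_uminus_def)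

text \<open>In the difference of the two inner products the terms pairing \<open>a\<close> with
  \<open>c\<close> and \<open>b\<close> with \<open>d\<close> cancel, while the mixed terms double;
  the two normalising factors multiply to 1/2 and absorb the 2.\<close>

lemma standard_unitary_form_rotation:
  "standard_unitary_form
     (complex_of_real (1 / sqrt 2) *\<^sub>C (a + b), complex_of_real (1 / sqrt 2) *\<^sub>C (a - b))
     (complex_of_real (1 / sqrt 2) *\<^sub>C (c + d), complex_of_real (1 / sqrt 2) *\<^sub>C (c - d)) =
   standard_symmetric_form (a, b) (c, d)"
proof -
  \<comment> \<open>Only two facts about the constant matter: its square is 1/2, and it is real, so
    it leaves the conjugate-linear argument unchanged.\<close>
  define r where "r = complex_of_real (1 / sqrt 2)"
  have r: "r * r = 1 / 2" "cnj r = r"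
    unfolding r_def by (simp_all flip: of_real_mult)
  have "standard_unitary_form (r *\<^sub>C (a + b), r *\<^sub>C (a - b)) (r *\<^sub>C (c + d), r *\<^sub>C (c - d)) =
      (r * r) * (2 * cinner a d + 2 * cinner b c)"
    by (simp add: standard_unitary_form_def cinner_scaleC_left cinner_scaleC_right r(2)
        cinner_add_left cinner_add_right cinner_diff_left cinner_diff_right algebra_simps)
  also have "\<dots> = standard_symmetric_form (a, b) (c, d)"
    by (simp add: r(1) standard_symmetric_form_def)
  finally show ?thesis
    by (simp only: r_def)
qed

text \<open>The normalised rotation is an involution, so the preimage of \<open>(p, q)\<close> is
  its own image: \<open>a = (p + q) / sqrt 2\<close> and
  \<open>b = (p - q) / sqrt 2\<close>.\<close>

lemma rotation_surj:
  fixes p q :: "'a::complex_hilbert"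
  obtains a b where "complex_of_real (1 / sqrt 2) *\<^sub>C (a + b) = p"
    "complex_of_real (1 / sqrt 2) *\<^sub>C (a - b) = q"
proof
  have half: "(1 / sqrt 2) *\<^sub>R (1 / sqrt 2) *\<^sub>R (x + x) = x" for x :: 'a
    by (simp flip: scaleR_2)
  show "complex_of_real (1 / sqrt 2) *\<^sub>C
      ((1 / sqrt 2) *\<^sub>R (p + q) + (1 / sqrt 2) *\<^sub>R (p - q)) = p"
    unfolding scaleC_of_real
    using half[of p] by (simp add: algebra_simps del: scaleR_scaleR)
  show "complex_of_real (1 / sqrt 2) *\<^sub>C
      ((1 / sqrt 2) *\<^sub>R (p + q) - (1 / sqrt 2) *\<^sub>R (p - q)) = q"
    unfolding scaleC_of_real
    using half[of q] by (simp add: algebra_simps del: scaleR_scaleR)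
qed

text \<open>Linearity pulls \<open>c\<close> out of \<open>L\<close>, and a nonzero scalar
  cancels.\<close>

lemma rotation_relation_iff:
  fixes L :: "'a::complex_hilbert \<Rightarrow> 'a"
  assumes "clinear_on UNIV L" "c \<noteq> 0"
  shows "L (c *\<^sub>C (a + b)) = c *\<^sub>C (a - b) \<longleftrightarrow> (L a - a) + (L b + b) = 0"
proof -
  have "L (c *\<^sub>C (a + b)) = c *\<^sub>C (L a + L b)"
    using assms(1) by (simp add: clinear_on_def)
  moreover have "c *\<^sub>C u = c *\<^sub>C v \<longleftrightarrow> u = v" for u v :: 'a
    using assms(2) by simp
  ultimately have "L (c *\<^sub>C (a + b)) = c *\<^sub>C (a - b) \<longleftrightarrow> L a + L b = a - b"
    by simp
  also have "\<dots> \<longleftrightarrow> (L a - a) + (L b + b) = 0"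
    using eq_iff_diff_eq_0[of "L a + L b" "a - b"] by (simp add: algebra_simps)
  finally show ?thesis .
qed

theorem proposition1:
  fixes H0 :: "('h::complex_hilbert \<times> 'h) set"
    and \<Gamma>1 \<Gamma>2 :: "'h \<Rightarrow> 'g::complex_hilbert"
    and F :: "'h \<times> 'h \<Rightarrow> 'g \<times> 'g"
  assumes "linear_operator H0"
    and "densely_defined H0"
    and "closed H0"
    and "skew_symmetric H0"
    and "boundary_triplet H0 \<Gamma>1 \<Gamma>2"
    and "\<And>x. x \<in> Domain (adjoint_op H0) \<Longrightarrow>
      F (x, op_apply (adjoint_op H0) x) =
        (complex_of_real (1 / sqrt 2) *\<^sub>C (\<Gamma>1 x + \<Gamma>2 x),
         complex_of_real (1 / sqrt 2) *\<^sub>C (\<Gamma>1 x - \<Gamma>2 x))"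
  shows "boundary_system H0 standard_symmetric_form F standard_unitary_form \<and>
    (\<forall>L :: 'g \<Rightarrow> 'g. unitary_operator L \<longrightarrow>
      triplet_domain H0 \<Gamma>1 \<Gamma>2 L = system_domain H0 F L \<and>
      triplet_operator H0 \<Gamma>1 \<Gamma>2 L = op_uminus (system_operator H0 F L))"
proof -
  let ?A = "adjoint_op H0"
  \<comment> \<open>\<open>F\<close> is prescribed at the points \<open>(x, op_apply ?A x)\<close>;
    for these to witness surjectivity on the graph, they must lie in it.\<close>
  have graph: "(x, op_apply ?A x) \<in> ?A" if "x \<in> Domain ?A" for x
    using single_valued_adjoint_op[OF assms(2)] that by (rule op_apply_in_graph)
  have surj: "(\<lambda>x. (\<Gamma>1 x, \<Gamma>2 x)) ` Domain ?A = UNIV"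
    and green: "\<And>x y. x \<in> Domain ?A \<Longrightarrow> y \<in> Domain ?A \<Longrightarrow>
      cinner (op_apply ?A x) y + cinner x (op_apply ?A y) =
      cinner (\<Gamma>1 x) (\<Gamma>2 y) + cinner (\<Gamma>2 x) (\<Gamma>1 y)"
    using assms(5) unfolding boundary_triplet_def Let_def Domain_op_uminus by (elim conjE; simp)+
  \<comment> \<open>Undo the rotation on \<open>w\<close>, then realise the resulting pair
    \<open>(a, b)\<close> as boundary values of some \<open>x\<close> by surjectivity of the
    triplet.\<close>
  have "w \<in> F ` ?A" for w
  proof -
    obtain a b where ab: "complex_of_real (1 / sqrt 2) *\<^sub>C (a + b) = fst w"
      "complex_of_real (1 / sqrt 2) *\<^sub>C (a - b) = snd w"
      by (rule rotation_surj)
    have "(a, b) \<in> (\<lambda>x. (\<Gamma>1 x, \<Gamma>2 x)) ` Domain ?A"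
      unfolding surj by (rule UNIV_I)
    then obtain x where x: "x \<in> Domain ?A" "\<Gamma>1 x = a" "\<Gamma>2 x = b"
      by blast
    have "F (x, op_apply ?A x) = w"
      unfolding assms(6)[OF x(1)] x(2,3) ab by simp
    then show ?thesis
      using graph[OF x(1)] by (metis imageI)
  qed
  then have range: "F ` ?A = UNIV"
    by blast
  have "standard_symmetric_form (x, op_apply ?A x) (y, op_apply ?A y) =
      standard_unitary_form (F (x, op_apply ?A x)) (F (y, op_apply ?A y))"
    if "x \<in> Domain ?A" "y \<in> Domain ?A" for x y
    \<comment> \<open>After the rotation the right-hand side is the symmetric form of the boundary
      values, so the claim is the Green identity \<open>green\<close> up to the order of the
      summands.\<close>
    unfolding assms(6)[OF that(1)] assms(6)[OF that(2)] standard_unitary_form_rotation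
    using green[OF that] by (simp add: standard_symmetric_form_def add.commute)
  with range have sys: "boundary_system H0 standard_symmetric_form F standard_unitary_form"
    by (simp add: boundary_system_def sesquilinear_standard_symmetric_form
        sesquilinear_standard_unitary_form)
  have dom: "triplet_domain H0 \<Gamma>1 \<Gamma>2 L = system_domain H0 F L" if "unitary_operator L" for L
  proof -
    have "L (fst (F (x, op_apply ?A x))) = snd (F (x, op_apply ?A x)) \<longleftrightarrow>
        (L (\<Gamma>1 x) - \<Gamma>1 x) + (L (\<Gamma>2 x) + \<Gamma>2 x) = 0" if "x \<in> Domain ?A" for x
      unfolding assms(6)[OF that] fst_conv snd_conv
      using \<open>unitary_operator L\<close>
      by (intro rotation_relation_iff) (auto simp: unitary_operator_def)
    then show ?thesis
      unfolding triplet_domain_def system_domain_def by blast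
  qed
  \<comment> \<open>Both operators restrict to the same domain by \<open>dom\<close>, and negation
    commutes with restriction.\<close>
  with sys show ?thesis
    by (simp add: triplet_operator_def system_operator_def op_restrict_op_uminus)
qed

end
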